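(* Let $n\geq3$, let $T$ be the $n$-regular tree, and let $H\leq\operatorname{Aut}(T)$ be vertex transitive. Then there exist a subgroup $F\leq S_n$, an involution $\tau$ of the index set of the $F$-orbits on $\{1,\dots,n\}$, and a $\tau$-legal labelling $l$ of $T$ such that $H\leq U^{(l)}(F)$. Moreover, these can be chosen so that the map $\sigma_{x,l}:H_x\to F$, $g\mapsto l_x\circ g\circ l_x^{-1}$, is surjective for every $x\in VT$, where $H_x$ is the stabiliser of $x$ in $H$.
   Context: $VT$ is the vertex set of $T$ and $ET$ is the set of oriented edges; each $e\in ET$ has an origin $o(e)$, a terminus $t(e)$ and an inverse edge $\bar e$. $E(x)$ is the set of $e\in ET$ with $o(e)=x$. $\operatorname{Aut}(T)$ is the automorphism group of $T$ (inversions allowed). Let $F\leq S_n$ and let $\{1,\dots,n\}=\sqcup_{i\in I}\Omega_i$ be the partition into $F$-orbits. Let $\tau$ be an involution of $I$ (i.e. $\tau^2=\mathrm{id}$; $\tau$ may be trivial). A map $l:ET\to\{1,\dots,n\}$ is a $\tau$-legal labelling of $T$ if (1) for all $x\in VT$ the map $l_x:E(x)\to\{1,\dots,n\}$, $e\mapsto l(e)$, is a bijection, and (2) for all $e\in ET$, if $l(e)\in\Omega_i$ then $l(\bar e)\in\Omega_{\tau(i)}$. The universal group of $T$ with respect to $l$ and $F$ is $$U^{(l)}(F)=\{g\in\operatorname{Aut}(T)\mid l_{gx}\circ g\circ l_x^{-1}\in F\text{ for all }x\in VT\},$$ where $g$ here denotes the induced bijection $E(x)\to E(gx)$. For $x\in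 VT$, the homomorphism $\sigma_{x,l}:U^{(l)}(F)_x\to F$ is $g\mapsto l_x\circ g\circ l_x^{-1}$; here it is restricted to $H_x$. *)

theory Defs
  imports
    "Graph_Theory.Bidirected_Digraph"
    "Graph_Theory.Digraph_Component"
    "HOL-Algebra.Sym_Groups"
    "HOL-Algebra.Group_Action"
begin

text \<open>
  A graph in the sense of Serre is a bidirected digraph: \<^term>\<open>tail T e\<close> is the origin of
  the oriented edge \<open>e\<close>, \<^term>\<open>head T e\<close> its terminus and \<open>arev e\<close> its inverse edge.
  The predicate \<^const>\<open>tree\<close> of the library forbids all directed cycles, hence also the
  backtracking cycle \<open>[e, arev e]\<close>, which exists in every bidirected digraph with an edge. Here only
  those backtracking cycles are admitted; longer cycles cannot backtrack, because their vertices are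
  distinct. The name is qualified since \<open>Cycles.cycle\<close> abbreviates \<^const>\<open>distinct\<close>.
\<close>

locale bidirected_tree = bidirected_digraph T arev
  for T :: "('v, 'e) pre_digraph" and arev :: "'e \<Rightarrow> 'e" +
  assumes connected: "connected T"
    and no_circuit: "pre_digraph.cycle T p \<Longrightarrow> \<exists>e. p = [e, arev e]"

locale regular_tree = bidirected_tree T arev
  for T :: "('v, 'e) pre_digraph" and arev :: "'e \<Rightarrow> 'e" +
  fixes n :: nat
  assumes regular: "x \<in> verts T \<Longrightarrow> finite (out_arcs T x) \<and> out_degree T x = n"

text \<open>
  An automorphism is a pair of a permutation of the vertices and a permutation of the oriented edges.
  As \<open>permutes\<close> demands the identity outside of the respective set, an automorphism is
  determined by its values on the graph.
\<close>

definition aut_group ::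
    "('v, 'e) pre_digraph \<Rightarrow> ('e \<Rightarrow> 'e) \<Rightarrow> (('v \<Rightarrow> 'v) \<times> ('e \<Rightarrow> 'e)) monoid" where
  "aut_group T arev =
    \<lparr>carrier = {g. fst g permutes verts T \<and> snd g permutes arcs T \<and>
       (\<forall>e\<in>arcs T. tail T (snd g e) = fst g (tail T e) \<and>
                   head T (snd g e) = fst g (head T e) \<and>
                   snd g (arev e) = arev (snd g e))},
     mult = (\<lambda>g h. (fst g \<circ> fst h, snd g \<circ> snd h)),
     one = (id, id)\<rparr>"

definition vertex_transitive ::
    "('v, 'e) pre_digraph \<Rightarrow> (('v \<Rightarrow> 'v) \<times> ('e \<Rightarrow> 'e)) set \<Rightarrow> bool" where
  "vertex_transitive T H \<longleftrightarrow> (\<forall>x\<in>verts T. \<forall>y\<in>verts T. \<exists>g\<in>H. fst g x = y)"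

definition perm_orbits :: "nat \<Rightarrow> (nat \<Rightarrow> nat) set \<Rightarrow> nat set set" where
  "perm_orbits n F = orbits (sym_group n\<lparr>carrier := F\<rparr>) {1..n} (\<lambda>p. p)"

text \<open>The identity counts as an involution.\<close>

definition involution_on :: "'i set \<Rightarrow> ('i \<Rightarrow> 'i) \<Rightarrow> bool" where
  "involution_on I \<tau> \<longleftrightarrow> \<tau> \<in> I \<rightarrow> I \<and> (\<forall>i\<in>I. \<tau> (\<tau> i) = i)"

text \<open>The partition into orbits is indexed by the orbits themselves.\<close>

definition legal_labelling ::
    "('v, 'e) pre_digraph \<Rightarrow> ('e \<Rightarrow> 'e) \<Rightarrow> nat \<Rightarrow> (nat \<Rightarrow> nat) set \<Rightarrow> (nat set \<Rightarrow> nat set)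
      \<Rightarrow> ('e \<Rightarrow> nat) \<Rightarrow> bool" where
  "legal_labelling T arev n F \<tau> l \<longleftrightarrow>
     (\<forall>x\<in>verts T. bij_betw l (out_arcs T x) {1..n}) \<and>
     (\<forall>e\<in>arcs T. \<forall>\<Omega>\<in>perm_orbits n F. l e \<in> \<Omega> \<longrightarrow> l (arev e) \<in> \<tau> \<Omega>)"

text \<open>
  The permutation \<open>l\<^bsub>gx\<^esub> \<circ> g \<circ> l\<^sub>x\<inverse>\<close> of \<open>{1..n}\<close>, extended by the identity in
  accordance with \<^const>\<open>sym_group\<close>. If \<open>g\<close> fixes \<open>x\<close>, then this is \<open>\<sigma>\<close> at \<open>x\<close>, evaluated at \<open>g\<close>.
\<close>

definition local_action ::
    "('v, 'e) pre_digraph \<Rightarrow> nat \<Rightarrow> ('e \<Rightarrow> nat) \<Rightarrow> 'v \<Rightarrow> ('v \<Rightarrow> 'v) \<times> ('e \<Rightarrow> 'e) \<Rightarrow> nat \<Rightarrow> nat" where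
  "local_action T n l x g = restrict_id (l \<circ> snd g \<circ> inv_into (out_arcs T x) l) {1..n}"

definition universal_group ::
    "('v, 'e) pre_digraph \<Rightarrow> ('e \<Rightarrow> 'e) \<Rightarrow> nat \<Rightarrow> ('e \<Rightarrow> nat) \<Rightarrow> (nat \<Rightarrow> nat) set
      \<Rightarrow> (('v \<Rightarrow> 'v) \<times> ('e \<Rightarrow> 'e)) monoid" where
  "universal_group T arev n l F =
     (aut_group T arev)\<lparr>carrier :=
       {g \<in> carrier (aut_group T arev). \<forall>x\<in>verts T. local_action T n l x g \<in> F}\<rparr>"

end

theory Submission
  imports Defs
begin

text \<open>
  The labels of a single star \<open>E(v)\<close> can be chosen at will, and \<open>H\<close> carries them to all other stars:
  pick for every vertex \<open>x\<close> some \<open>s\<^sub>x \<in> H\<close> with \<open>s\<^sub>x v = x\<close>, where \<open>s\<^sub>v = id\<close>, and give \<open>s\<^sub>x e\<close> the label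
  of \<open>e\<close>. Then \<open>s\<^sub>x\<close> acts on labels as the identity. For any \<open>g \<in> H\<close> with \<open>g x = y\<close> the factorisation
  \<open>g = s\<^sub>y h s\<^sub>x\<inverse>\<close> with \<open>h \<in> H\<^sub>v\<close> shows that the local action of \<open>g\<close> at \<open>x\<close> equals that of \<open>h\<close> at \<open>v\<close>.
  Hence, if \<open>F\<close> is the permutation group that \<open>H\<^sub>v\<close> induces on the labels at \<open>v\<close>, the elements of \<open>H\<close>
  that take \<open>x\<close> to \<open>y\<close> induce at \<open>x\<close> precisely the permutations in \<open>F\<close>, for any two
  vertices \<open>x\<close> and \<open>y\<close> (lemma \<open>exists_uniform_labelling\<close>).

  This uniformity has all the claims as consequences. The case \<open>x = y\<close> says that \<open>\<sigma>\<^sub>x\<close>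
  maps \<open>H\<^sub>x\<close> onto \<open>F\<close>, and the inclusion of \<open>H\<close> in the universal group is one half of the property.
  As to \<open>\<tau>\<close>, the other half shows that the labels of two edges lie in the same \<open>F\<close>-orbit if and only if
  the edges lie in the same \<open>H\<close>-orbit (lemma \<open>same_label_orbit_iff\<close>). Edge inversion commutes with
  automorphisms, so it permutes the \<open>H\<close>-orbits of edges, and \<open>\<tau>\<close> is this involution, read on labels.
\<close>

section \<open>Automorphisms of a bidirected graph\<close>

context bidirected_digraph
begin

abbreviation Aut :: "(('a \<Rightarrow> 'a) \<times> ('b \<Rightarrow> 'b)) monoid" where
  "Aut \<equiv> aut_group G arev"

lemma carrier_AutD:
  assumes "g \<in> carrier Aut"
  shows "fst g permutes verts G" "snd g permutes arcs G"
    and "e \<in> arcs G \<Longrightarrow> tail G (snd g e) = fst g (tail G e)"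
    and "e \<in> arcs G \<Longrightarrow> head G (snd g e) = fst g (head G e)"
    and "e \<in> arcs G \<Longrightarrow> snd g (arev e) = arev (snd g e)"
  using assms by (auto simp: aut_group_def)

lemma mult_Aut: "g \<otimes>\<^bsub>Aut\<^esub> h = (fst g \<circ> fst h, snd g \<circ> snd h)"
  by (simp add: aut_group_def)

lemma one_Aut: "\<one>\<^bsub>Aut\<^esub> = (id, id)"
  by (simp add: aut_group_def)

lemma Aut_inverse_closed:
  assumes "g \<in> carrier Aut"
  shows "(inv_into UNIV (fst g), inv_into UNIV (snd g)) \<in> carrier Aut"
proof -
  note g = carrier_AutD[OF assms]
  let ?v = "inv_into UNIV (fst g)" and ?a = "inv_into UNIV (snd g)"
  have "tail G (?a e) = ?v (tail G e) \<and> head G (?a e) = ?v (head G e) \<and> ?a (arev e) = arev (?a e)"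
    if e: "e \<in> arcs G" for e
  proof -
    obtain d where d: "d \<in> arcs G" "e = snd g d"
      using e g(2) by (metis permutes_image imageE)
    have "?a e = d" "?v (fst g x) = x" for x
      using d permutes_inverses(2)[OF g(1)] permutes_inverses(2)[OF g(2)] by auto
    moreover have "?a (arev e) = arev d"
      using d g(5)[OF d(1)] permutes_inverses(2)[OF g(2)] by metis
    ultimately show ?thesis
      using g(3,4)[OF d(1)] d(2) by simp
  qed
  then show ?thesis
    using g(1,2) by (simp add: aut_group_def permutes_inv)
qed

lemma group_Aut: "group Aut"
proof (rule groupI)
  fix g h assume "g \<in> carrier Aut" "h \<in> carrier Aut"
  then show "g \<otimes>\<^bsub>Aut\<^esub> h \<in> carrier Aut"
    by (auto simp: aut_group_def permutes_compose permutes_in_image)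
next
  show "\<one>\<^bsub>Aut\<^esub> \<in> carrier Aut"
    by (simp add: aut_group_def permutes_id)
next
  fix g assume g: "g \<in> carrier Aut"
  then have "(inv_into UNIV (fst g), inv_into UNIV (snd g)) \<otimes>\<^bsub>Aut\<^esub> g = \<one>\<^bsub>Aut\<^esub>"
    using permutes_inv_o(2)[OF carrier_AutD(1)[OF g]] permutes_inv_o(2)[OF carrier_AutD(2)[OF g]]
    by (simp add: mult_Aut one_Aut)
  then show "\<exists>h\<in>carrier Aut. h \<otimes>\<^bsub>Aut\<^esub> g = \<one>\<^bsub>Aut\<^esub>"
    using Aut_inverse_closed[OF g] by blast
qed (simp_all add: mult_Aut one_Aut comp_assoc)

sublocale Aut: group Aut
  by (rule group_Aut)

lemma Aut_inv_vertex:
  assumes "g \<in> carrier Aut" "fst g x = y"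
  shows "fst (inv\<^bsub>Aut\<^esub> g) y = x"
proof -
  have "fst (inv\<^bsub>Aut\<^esub> g) \<circ> fst g = id"
    using Aut.l_inv[OF assms(1)] by (simp add: mult_Aut one_Aut)
  then show ?thesis
    using assms(2) by (metis comp_apply id_apply)
qed

lemma Aut_vertex_closed: "g \<in> carrier Aut \<Longrightarrow> x \<in> verts G \<Longrightarrow> fst g x \<in> verts G"
  by (simp add: carrier_AutD(1) permutes_in_image)

lemma Aut_out_arcs_closed:
  assumes "g \<in> carrier Aut" "e \<in> out_arcs G x"
  shows "snd g e \<in> out_arcs G (fst g x)"
  using assms carrier_AutD[OF assms(1)] by (auto simp: permutes_in_image)

lemma Aut_bij_betw_out_arcs:
  assumes g: "g \<in> carrier Aut"
  shows "bij_betw (snd g) (out_arcs G x) (out_arcs G (fst g x))"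
proof -
  have "e \<in> snd g ` out_arcs G x" if e: "e \<in> out_arcs G (fst g x)" for e
  proof -
    obtain d where d: "d \<in> arcs G" "e = snd g d"
      using e carrier_AutD(2)[OF g] by (auto, metis permutes_image imageE)
    then have "fst g (tail G d) = fst g x"
      using e carrier_AutD(3)[OF g] by simp
    then have "tail G d = x"
      using permutes_inj[OF carrier_AutD(1)[OF g]] by (simp add: inj_eq)
    then show ?thesis
      using d by simp
  qed
  then have "snd g ` out_arcs G x = out_arcs G (fst g x)"
    using Aut_out_arcs_closed[OF g] by blast
  then show ?thesis
    by (simp add: bij_betw_def inj_on_subset[OF permutes_inj[OF carrier_AutD(2)[OF g]]])
qed

end

section \<open>Local actions\<close>

locale star_labelling = bidirected_digraph T arev
  for T :: "('v, 'e) pre_digraph" and arev :: "'e \<Rightarrow> 'e" +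
  fixes n :: nat and l :: "'e \<Rightarrow> nat"
  assumes label_bij: "x \<in> verts T \<Longrightarrow> bij_betw l (out_arcs T x) {1..n}"
begin

abbreviation \<sigma> :: "'v \<Rightarrow> ('v \<Rightarrow> 'v) \<times> ('e \<Rightarrow> 'e) \<Rightarrow> nat \<Rightarrow> nat" where
  "\<sigma> \<equiv> local_action T n l"

lemma label_range: "e \<in> arcs T \<Longrightarrow> l e \<in> {1..n}"
  using label_bij[of "tail T e"] by (auto simp: bij_betw_def)

lemma label_ex:
  assumes "x \<in> verts T" "i \<in> {1..n}"
  obtains e where "e \<in> out_arcs T x" "l e = i"
  using bij_betw_imp_surj_on[OF label_bij[OF assms(1)]] assms(2) by (metis imageE)

lemma local_action_label:
  assumes "e \<in> arcs T"
  shows "\<sigma> (tail T e) g (l e) = l (snd g e)"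
proof -
  have "inj_on l (out_arcs T (tail T e))"
    using label_bij[of "tail T e"] assms by (simp add: bij_betw_def)
  then have "inv_into (out_arcs T (tail T e)) l (l e) = e"
    using assms by (simp add: inv_into_f_f)
  then show ?thesis
    using label_range[OF assms] by (simp add: local_action_def restrict_id_def)
qed

lemma local_action_outside: "i \<notin> {1..n} \<Longrightarrow> \<sigma> x g i = i"
  by (auto simp: local_action_def restrict_id_def)

text \<open>
  Identities between local actions are checked on the labels of a star, so that the inverse of \<open>l\<^sub>x\<close>
  does not enter into them.
\<close>

lemma local_action_eqI:
  assumes "x \<in> verts T" and "\<And>i. i \<notin> {1..n} \<Longrightarrow> f i = i"
    and "\<And>e. e \<in> out_arcs T x \<Longrightarrow> f (l e) = l (snd g e)"
  shows "\<sigma> x g = f"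
proof
  fix i
  show "\<sigma> x g i = f i"
  proof (cases "i \<in> {1..n}")
    case True
    then obtain e where e: "e \<in> out_arcs T x" "l e = i"
      using label_ex assms(1) by metis
    then show ?thesis
      using assms(3)[OF e(1)] local_action_label[of e g] by auto
  qed (simp add: assms(2) local_action_outside del: atLeastAtMost_iff)
qed

lemma local_action_mult:
  assumes "x \<in> verts T" "h \<in> carrier Aut"
  shows "\<sigma> x (g \<otimes>\<^bsub>Aut\<^esub> h) = \<sigma> (fst h x) g \<circ> \<sigma> x h"
proof (rule local_action_eqI[OF assms(1)])
  fix e assume e: "e \<in> out_arcs T x"
  then have "snd h e \<in> out_arcs T (fst h x)"
    using Aut_out_arcs_closed assms(2) by blast
  then show "(\<sigma> (fst h x) g \<circ> \<sigma> x h) (l e) = l (snd (g \<otimes>\<^bsub>Aut\<^esub> h) e)"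
    using local_action_label[of e h] local_action_label[of "snd h e" g] e by (simp add: mult_Aut)
qed (simp add: local_action_outside del: atLeastAtMost_iff)

lemma local_action_one: "x \<in> verts T \<Longrightarrow> \<sigma> x \<one>\<^bsub>Aut\<^esub> = id"
  by (rule local_action_eqI) (simp_all add: one_Aut)

lemma local_action_permutes:
  assumes x: "x \<in> verts T" and g: "g \<in> carrier Aut"
  shows "\<sigma> x g permutes {1..n}"
proof (rule bij_imp_permutes)
  have "bij_betw (l \<circ> (snd g \<circ> inv_into (out_arcs T x) l)) {1..n} {1..n}"
    using bij_betw_inv_into[OF label_bij[OF x]] Aut_bij_betw_out_arcs[OF g]
      label_bij[OF Aut_vertex_closed[OF g x]] bij_betw_trans by metis
  then show "bij_betw (\<sigma> x g) {1..n} {1..n}"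
    by (subst bij_betw_cong[where g = "l \<circ> (snd g \<circ> inv_into (out_arcs T x) l)"])
      (simp_all add: local_action_def restrict_id_def)
qed (rule local_action_outside)

lemma local_action_inv:
  assumes "x \<in> verts T" "g \<in> carrier Aut"
  shows "\<sigma> (fst g x) (inv\<^bsub>Aut\<^esub> g) = inv_into UNIV (\<sigma> x g)"
proof -
  have "\<sigma> (fst g x) (inv\<^bsub>Aut\<^esub> g) \<circ> \<sigma> x g = id"
    using local_action_mult[OF assms, of "inv\<^bsub>Aut\<^esub> g"] local_action_one assms Aut.l_inv by metis
  moreover have "\<sigma> x g \<circ> inv_into UNIV (\<sigma> x g) = id"
    using permutes_inv_o(1)[OF local_action_permutes[OF assms]] .
  ultimately show ?thesis
    by (metis comp_assoc comp_id id_comp)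
qed

lemma subgroup_universal_group:
  assumes "subgroup F (sym_group n)"
  shows "subgroup (carrier (universal_group T arev n l F)) Aut"
proof (rule Aut.subgroupI)
  let ?U = "carrier (universal_group T arev n l F)"
  have U: "g \<in> ?U \<longleftrightarrow> g \<in> carrier Aut \<and> (\<forall>x\<in>verts T. \<sigma> x g \<in> F)" for g
    by (simp add: universal_group_def)
  show "?U \<subseteq> carrier Aut"
    using U by blast
  have "id \<in> F"
    using subgroup.one_closed[OF assms] by (simp add: sym_group_one)
  then have "\<one>\<^bsub>Aut\<^esub> \<in> ?U"
    by (simp add: U local_action_one)
  then show "?U \<noteq> {}"
    by blast
  fix g assume g: "g \<in> ?U"
  have gA: "g \<in> carrier Aut"
    using g U by blast
  have "\<sigma> x (inv\<^bsub>Aut\<^esub> g) \<in> F" if x: "x \<in> verts T" for x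
  proof -
    obtain y where y: "y \<in> verts T" "fst g y = x"
      using x carrier_AutD(1)[OF gA] by (metis permutes_image imageE)
    have "inv\<^bsub>sym_group n\<^esub> (\<sigma> y g) \<in> F"
      using g U y subgroup.m_inv_closed[OF assms] by blast
    then show ?thesis
      using local_action_inv[OF y(1) gA] y local_action_permutes[OF y(1) gA]
      by (simp add: sym_group_carrier)
  qed
  then show "inv\<^bsub>Aut\<^esub> g \<in> ?U"
    using U gA by simp
  fix h assume h: "h \<in> ?U"
  have hA: "h \<in> carrier Aut"
    using h U by blast
  have "\<sigma> x (g \<otimes>\<^bsub>Aut\<^esub> h) \<in> F" if x: "x \<in> verts T" for x
    using local_action_mult[OF x hA, of g] subgroup.m_closed[OF assms, of "\<sigma> (fst h x) g" "\<sigma> x h"]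
      g h x Aut_vertex_closed[OF hA x] by (simp add: U sym_group_mult)
  then show "g \<otimes>\<^bsub>Aut\<^esub> h \<in> ?U"
    using U gA hA by simp
qed

end

section \<open>Uniform labellings\<close>

text \<open>
  The local actions of \<open>H\<close> between any two vertices, not only at a fixed vertex, form the same set \<open>F\<close>.
\<close>

locale uniform_labelling = star_labelling T arev n l
  for T :: "('v, 'e) pre_digraph" and arev :: "'e \<Rightarrow> 'e" and n :: nat and l :: "'e \<Rightarrow> nat" +
  fixes H :: "(('v \<Rightarrow> 'v) \<times> ('e \<Rightarrow> 'e)) set" and F :: "(nat \<Rightarrow> nat) set"
  assumes subgroup_H: "subgroup H Aut"
    and verts_nonempty: "verts T \<noteq> {}"
    and uniform: "x \<in> verts T \<Longrightarrow> y \<in> verts T \<Longrightarrow> \<sigma> x ` {g \<in> H. fst g x = y} = F"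
begin

lemma H_Aut: "g \<in> H \<Longrightarrow> g \<in> carrier Aut"
  using subgroup.subset[OF subgroup_H] by blast

lemma local_action_in:
  assumes "g \<in> H" "x \<in> verts T"
  shows "\<sigma> x g \<in> F"
proof -
  have "\<sigma> x g \<in> \<sigma> x ` {h \<in> H. fst h x = fst g x}"
    using assms by blast
  then show ?thesis
    by (simp only: uniform[OF assms(2) Aut_vertex_closed[OF H_Aut[OF assms(1)] assms(2)]])
qed

lemma local_action_onto:
  assumes "f \<in> F" "x \<in> verts T" "y \<in> verts T"
  obtains g where "g \<in> H" "fst g x = y" "\<sigma> x g = f"
proof -
  have "f \<in> \<sigma> x ` {g \<in> H. fst g x = y}"
    using assms(1) by (simp only: uniform[OF assms(2,3)])
  then show thesis
    using that by blast
qed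

lemma F_permutes:
  assumes "f \<in> F"
  shows "f permutes {1..n}"
proof -
  obtain v where v: "v \<in> verts T"
    using verts_nonempty by blast
  obtain g where g: "g \<in> H" "\<sigma> v g = f"
    using local_action_onto[OF assms v v] by blast
  show ?thesis
    using local_action_permutes[OF v H_Aut[OF g(1)]] g(2) by simp
qed

lemma subgroup_F: "subgroup F (sym_group n)"
proof (rule group.subgroupI[OF sym_group_is_group])
  obtain v where v: "v \<in> verts T"
    using verts_nonempty by blast
  show "F \<subseteq> carrier (sym_group n)"
    using F_permutes by (auto simp: sym_group_carrier)
  show "F \<noteq> {}"
    using local_action_in[OF subgroup.one_closed[OF subgroup_H] v] by blast
  fix f assume f: "f \<in> F"
  obtain g where g: "g \<in> H" "fst g v = v" "\<sigma> v g = f"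
    using local_action_onto[OF f v v] by blast
  have "inv_into UNIV f = \<sigma> v (inv\<^bsub>Aut\<^esub> g)"
    using local_action_inv[OF v H_Aut[OF g(1)]] g by simp
  then show "inv\<^bsub>sym_group n\<^esub> f \<in> F"
    using local_action_in[OF subgroup.m_inv_closed[OF subgroup_H g(1)] v] F_permutes[OF f]
    by (simp add: sym_group_carrier)
  fix f' assume f': "f' \<in> F"
  obtain g' where g': "g' \<in> H" "fst g' v = v" "\<sigma> v g' = f'"
    using local_action_onto[OF f' v v] by blast
  have "f \<circ> f' = \<sigma> v (g \<otimes>\<^bsub>Aut\<^esub> g')"
    using local_action_mult[OF v H_Aut[OF g'(1)]] g g' by simp
  then show "f \<otimes>\<^bsub>sym_group n\<^esub> f' \<in> F"
    using local_action_in[OF subgroup.m_closed[OF subgroup_H g(1) g'(1)] v]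
    by (simp add: sym_group_mult)
qed

lemma H_subgroup_universal_group: "subgroup H (universal_group T arev n l F)"
proof -
  have "H \<subseteq> carrier (universal_group T arev n l F)"
    using H_Aut local_action_in by (auto simp: universal_group_def)
  then have "subgroup H (Aut\<lparr>carrier := carrier (universal_group T arev n l F)\<rparr>)"
    using Aut.subgroup_incl subgroup_H subgroup_universal_group[OF subgroup_F] by blast
  then show ?thesis
    by (simp add: universal_group_def)
qed

text \<open>
  A permutation \<open>f \<in> F\<close> with \<open>f (l e) = l e'\<close> can be realised by an element of \<open>H\<close> that also takes the
  origin of \<open>e\<close> to the origin of \<open>e'\<close>. This element takes \<open>e\<close> to an edge in the star of \<open>e'\<close> with the
  label of \<open>e'\<close>, hence to \<open>e'\<close> itself.
\<close>

lemma same_label_orbit_iff: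
  assumes e: "e \<in> arcs T" and e': "e' \<in> arcs T"
  shows "(\<exists>f\<in>F. l e' = f (l e)) \<longleftrightarrow> (\<exists>g\<in>H. e' = snd g e)"
proof
  assume "\<exists>f\<in>F. l e' = f (l e)"
  then obtain f where f: "f \<in> F" "l e' = f (l e)"
    by blast
  obtain g where g: "g \<in> H" "fst g (tail T e) = tail T e'" "\<sigma> (tail T e) g = f"
    using local_action_onto[OF f(1) tail_in_verts[OF e] tail_in_verts[OF e']] by blast
  have "l e' = l (snd g e)"
    using local_action_label[OF e, of g] f g by simp
  moreover have "snd g e \<in> out_arcs T (tail T e')"
    using Aut_out_arcs_closed[OF H_Aut[OF g(1)], of e "tail T e"] e g by simp
  moreover have "inj_on l (out_arcs T (tail T e'))"
    using label_bij[of "tail T e'"] e' by (simp add: bij_betw_def)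
  ultimately have "e' = snd g e"
    using e' by (auto dest: inj_onD)
  then show "\<exists>g\<in>H. e' = snd g e"
    using g(1) by blast
next
  assume "\<exists>g\<in>H. e' = snd g e"
  then obtain g where g: "g \<in> H" "e' = snd g e"
    by blast
  then have "l e' = \<sigma> (tail T e) g (l e)"
    using local_action_label[OF e, of g] by simp
  then show "\<exists>f\<in>F. l e' = f (l e)"
    using local_action_in[OF g(1) tail_in_verts[OF e]] by blast
qed

lemma arev_same_label_orbit:
  assumes "e \<in> arcs T" "e' \<in> arcs T" "\<exists>f\<in>F. l e' = f (l e)"
  shows "\<exists>f\<in>F. l (arev e') = f (l (arev e))"
proof -
  obtain g where g: "g \<in> H" "e' = snd g e"
    using assms same_label_orbit_iff[of e e'] by blast
  then have "arev e' = snd g (arev e)"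
    using carrier_AutD(5)[OF H_Aut[OF g(1)] assms(1)] by simp
  then show ?thesis
    using g(1) same_label_orbit_iff[OF arev_in_arcs[OF assms(1)] arev_in_arcs[OF assms(2)]] by blast
qed

text \<open>
  Since labels are attained at every vertex, an \<open>F\<close>-orbit can be represented by the label of an edge.
\<close>

lemma perm_orbits_eq: "perm_orbits n F = (\<lambda>e. {f (l e) | f. f \<in> F}) ` arcs T"
proof -
  obtain v where v: "v \<in> verts T"
    using verts_nonempty by blast
  have "i \<in> l ` arcs T" if i: "i \<in> {1..n}" for i
  proof -
    obtain e where "e \<in> out_arcs T v" "l e = i"
      using label_ex[OF v i] by blast
    then show ?thesis
      by auto
  qed
  then have "{1..n} = l ` arcs T"
    using label_range by blast
  moreover have "perm_orbits n F = (\<lambda>i. {f i | f. f \<in> F}) ` {1..n}"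
    by (auto simp: perm_orbits_def orbits_def orbit_def)
  ultimately show ?thesis
    by (simp only: image_image)
qed

lemma perm_orbit_eq:
  assumes "\<Omega> \<in> perm_orbits n F" "l e \<in> \<Omega>" "e \<in> arcs T"
  shows "\<Omega> = {f (l e) | f. f \<in> F}"
proof -
  obtain d where d: "d \<in> arcs T" "\<Omega> = {f (l d) | f. f \<in> F}"
    using assms(1) by (auto simp: perm_orbits_eq)
  obtain f where f: "f \<in> F" "l e = f (l d)"
    using assms(2) d(2) by blast
  note perm = F_permutes[OF f(1)]
  have "inv\<^bsub>sym_group n\<^esub> f \<in> F"
    using f(1) by (rule subgroup.m_inv_closed[OF subgroup_F])
  then have inv: "inv_into UNIV f \<in> F"
    using perm by (simp add: sym_group_carrier)
  have comp: "p \<circ> q \<in> F" if "p \<in> F" "q \<in> F" for p q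
    using subgroup.m_closed[OF subgroup_F that] by (simp add: sym_group_mult)
  have l_d: "l d = inv_into UNIV f (l e)"
    using permutes_inverses(2)[OF perm] f(2) by simp
  have "p (l d) \<in> {f (l e) | f. f \<in> F}" if "p \<in> F" for p
    using comp[OF that inv] l_d by (auto simp: o_def)
  moreover have "p (l e) \<in> \<Omega>" if "p \<in> F" for p
    using comp[OF that f(1)] d(2) f(2) by (auto simp: o_def)
  ultimately show ?thesis
    using d(2) by blast
qed

definition reversal :: "nat set \<Rightarrow> nat set" where
  "reversal \<Omega> = l ` arev ` {e \<in> arcs T. l e \<in> \<Omega>}"

text \<open>
  On orbits, \<open>reversal\<close> is induced by edge inversion, because the labels of \<open>d\<close> and \<open>e\<close> are in the same
  \<open>F\<close>-orbit if and only if those of \<open>arev d\<close> and \<open>arev e\<close> are.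
\<close>

lemma reversal_orbit:
  assumes e: "e \<in> arcs T"
  shows "reversal {f (l e) | f. f \<in> F} = {f (l (arev e)) | f. f \<in> F}"
proof (rule Set.set_eqI)
  fix i
  have "i \<in> reversal {f (l e) | f. f \<in> F} \<longleftrightarrow>
      (\<exists>d\<in>arcs T. (\<exists>f\<in>F. l d = f (l e)) \<and> i = l (arev d))"
    by (auto simp: reversal_def)
  also have "\<dots> \<longleftrightarrow> (\<exists>d\<in>arcs T. (\<exists>f\<in>F. l (arev d) = f (l (arev e))) \<and> i = l (arev d))"
  proof -
    have "(\<exists>f\<in>F. l (arev d) = f (l (arev e))) \<longleftrightarrow> (\<exists>f\<in>F. l d = f (l e))" if d: "d \<in> arcs T" for d
      using arev_same_label_orbit[OF e d]
        arev_same_label_orbit[OF arev_in_arcs[OF e] arev_in_arcs[OF d]] by auto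
    then show ?thesis
      by blast
  qed
  also have "\<dots> \<longleftrightarrow> (\<exists>d\<in>arcs T. (\<exists>f\<in>F. l d = f (l (arev e))) \<and> i = l d)"
  proof -
    have "(\<exists>d\<in>arcs T. P (arev d)) \<longleftrightarrow> (\<exists>d\<in>arcs T. P d)" for P
      by (metis arev_arev arev_in_arcs)
    then show ?thesis .
  qed
  also have "\<dots> \<longleftrightarrow> i \<in> {f (l (arev e)) | f. f \<in> F}"
  proof -
    have "\<exists>d\<in>arcs T. f (l (arev e)) = l d" if "f \<in> F" for f
    proof -
      have i: "f (l (arev e)) \<in> {1..n}"
        using label_range[OF arev_in_arcs[OF e]] permutes_in_image[OF F_permutes[OF that]] by blast
      obtain d where "d \<in> out_arcs T (tail T e)" "l d = f (l (arev e))"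
        using label_ex[OF tail_in_verts[OF e] i] by blast
      then show ?thesis
        by force
    qed
    then show ?thesis
      by (intro iffI) (blast, clarify, metis)
  qed
  finally show "i \<in> reversal {f (l e) | f. f \<in> F} \<longleftrightarrow> i \<in> {f (l (arev e)) | f. f \<in> F}" .
qed

lemma involution_reversal: "involution_on (perm_orbits n F) reversal"
  by (auto simp: involution_on_def perm_orbits_eq reversal_orbit)

lemma legal_labelling_reversal: "legal_labelling T arev n F reversal l"
  unfolding legal_labelling_def reversal_def using label_bij by blast

lemma local_action_stabilizer:
  assumes "x \<in> verts T"
  shows "\<sigma> x ` stabilizer (Aut\<lparr>carrier := H\<rparr>) fst x = F"
  using uniform[OF assms assms] by (simp add: stabilizer_def)

end

section \<open>Transporting the labels of one star\<close>

lemma (in bidirected_digraph) exists_uniform_labelling: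
  assumes H: "subgroup H Aut" and trans: "vertex_transitive G H"
    and v: "v \<in> verts G" and lab: "bij_betw lab (out_arcs G v) {1..n}"
  shows "\<exists>l F. uniform_labelling G arev n l H F"
proof -
  have HA: "g \<in> carrier Aut" if "g \<in> H" for g
    using subgroup.subset[OF H] that by blast
  note closed = subgroup.m_closed[OF H] subgroup.m_inv_closed[OF H] subgroup.one_closed[OF H]
  have "\<forall>x\<in>verts G. \<exists>g\<in>H. fst g v = x \<and> (x = v \<longrightarrow> g = \<one>\<^bsub>Aut\<^esub>)"
  proof
    fix x assume "x \<in> verts G"
    then show "\<exists>g\<in>H. fst g v = x \<and> (x = v \<longrightarrow> g = \<one>\<^bsub>Aut\<^esub>)"
      using trans v closed(3) by (cases "x = v") (auto simp: vertex_transitive_def one_Aut)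
  qed
  then obtain s where s: "\<And>x. x \<in> verts G \<Longrightarrow> s x \<in> H"
    "\<And>x. x \<in> verts G \<Longrightarrow> fst (s x) v = x" and sv: "s v = \<one>\<^bsub>Aut\<^esub>"
    using v by metis
  define l where "l e = lab (inv_into UNIV (snd (s (tail G e))) e)" for e
  have l_s: "l (snd (s x) e) = lab e" if "x \<in> verts G" "e \<in> out_arcs G v" for x e
  proof -
    have "tail G (snd (s x) e) = x"
      using Aut_out_arcs_closed[OF HA[OF s(1)], of x e v] s(2) that by simp
    then show ?thesis
      using permutes_inverses(2)[OF carrier_AutD(2)[OF HA[OF s(1)]]] that by (simp add: l_def)
  qed
  interpret star_labelling G arev n l
  proof
    fix x assume x: "x \<in> verts G"
    have "bij_betw (l \<circ> snd (s x)) (out_arcs G v) {1..n}"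
      using lab by (rule bij_betw_cong[THEN iffD1, rotated]) (simp add: l_s[OF x])
    moreover have "bij_betw (snd (s x)) (out_arcs G v) (out_arcs G x)"
      using Aut_bij_betw_out_arcs[OF HA[OF s(1)[OF x]], of v] s(2)[OF x] by simp
    ultimately show "bij_betw l (out_arcs G x) {1..n}"
      by (simp add: bij_betw_comp_iff)
  qed
  \<comment> \<open>By the choice of \<open>s v\<close>, the labelling \<open>l\<close> agrees with \<open>lab\<close> on the star of \<open>v\<close>.\<close>
  have \<sigma>_s: "\<sigma> v (s x) = id" if "x \<in> verts G" for x
    using l_s[OF that] l_s[OF v] by (intro local_action_eqI[OF v]) (simp_all add: sv one_Aut)
  have \<sigma>_transport: "\<sigma> x g = \<sigma> v h"
    if "x \<in> verts G" "y \<in> verts G" "g \<in> H" "h \<in> H" "fst h v = v"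
      and eq: "g \<otimes>\<^bsub>Aut\<^esub> s x = s y \<otimes>\<^bsub>Aut\<^esub> h" for x y g h
  proof -
    have "\<sigma> x g = \<sigma> v (g \<otimes>\<^bsub>Aut\<^esub> s x)"
      using local_action_mult[OF v HA[OF s(1)[OF that(1)]], of g] \<sigma>_s[OF that(1)] s(2)[OF that(1)]
      by simp
    also have "\<dots> = \<sigma> v h"
      using local_action_mult[OF v HA[OF that(4)], of "s y"] \<sigma>_s[OF that(2)] that(5) eq by simp
    finally show ?thesis .
  qed
  have "\<sigma> x ` {g \<in> H. fst g x = y} = \<sigma> v ` {h \<in> H. fst h v = v}"
    if x: "x \<in> verts G" and y: "y \<in> verts G" for x y
  proof (intro subset_antisym subsetI)
    fix f assume "f \<in> \<sigma> x ` {g \<in> H. fst g x = y}"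
    then obtain g where g: "g \<in> H" "fst g x = y" "f = \<sigma> x g"
      by blast
    let ?h = "inv\<^bsub>Aut\<^esub> s y \<otimes>\<^bsub>Aut\<^esub> (g \<otimes>\<^bsub>Aut\<^esub> s x)"
    have h: "?h \<in> H"
      by (rule closed(1)[OF closed(2)[OF s(1)[OF y]] closed(1)[OF g(1) s(1)[OF x]]])
    have hv: "fst ?h v = v"
      using Aut_inv_vertex[OF HA[OF s(1)[OF y]] s(2)[OF y]] g(2) s(2)[OF x] by (simp add: mult_Aut)
    have "g \<otimes>\<^bsub>Aut\<^esub> s x = s y \<otimes>\<^bsub>Aut\<^esub> ?h"
      by (simp add: Aut.m_assoc[symmetric] HA[OF s(1)[OF x]] HA[OF s(1)[OF y]] HA[OF g(1)])
    then have "f = \<sigma> v ?h"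
      using \<sigma>_transport[OF x y g(1) h hv] g(3) by simp
    then show "f \<in> \<sigma> v ` {h \<in> H. fst h v = v}"
      using h hv by blast
  next
    fix f assume "f \<in> \<sigma> v ` {h \<in> H. fst h v = v}"
    then obtain h where h: "h \<in> H" "fst h v = v" "f = \<sigma> v h"
      by blast
    let ?g = "s y \<otimes>\<^bsub>Aut\<^esub> h \<otimes>\<^bsub>Aut\<^esub> inv\<^bsub>Aut\<^esub> s x"
    have g: "?g \<in> H"
      by (rule closed(1)[OF closed(1)[OF s(1)[OF y] h(1)] closed(2)[OF s(1)[OF x]]])
    have gx: "fst ?g x = y"
      using Aut_inv_vertex[OF HA[OF s(1)[OF x]] s(2)[OF x]] h(2) s(2)[OF y] by (simp add: mult_Aut)
    have "?g \<otimes>\<^bsub>Aut\<^esub> s x = s y \<otimes>\<^bsub>Aut\<^esub> h"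
      by (simp add: Aut.m_assoc HA[OF s(1)[OF x]] HA[OF s(1)[OF y]] HA[OF h(1)])
    then have "f = \<sigma> x ?g"
      using \<sigma>_transport[OF x y g h(1,2)] h(3) by simp
    then show "f \<in> \<sigma> x ` {g \<in> H. fst g x = y}"
      using g gx by blast
  qed
  then have "uniform_labelling G arev n l H (\<sigma> v ` {h \<in> H. fst h v = v})"
    by (intro uniform_labelling.intro uniform_labelling_axioms.intro star_labelling_axioms H)
      (use v in blast)
  then show ?thesis
    by blast
qed

theorem proposition3p4:
  fixes T :: "('v, 'e) pre_digraph" and arev :: "'e \<Rightarrow> 'e" and n :: nat
    and H :: "(('v \<Rightarrow> 'v) \<times> ('e \<Rightarrow> 'e)) set"
  assumes "n \<ge> 3"
    and "regular_tree T arev n"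
    and "subgroup H (aut_group T arev)"
    and "vertex_transitive T H"
  shows "\<exists>F \<tau> l. subgroup F (sym_group n) \<and>
           involution_on (perm_orbits n F) \<tau> \<and>
           legal_labelling T arev n F \<tau> l \<and>
           subgroup H (universal_group T arev n l F) \<and>
           (\<forall>x\<in>verts T.
              local_action T n l x ` stabilizer (aut_group T arev\<lparr>carrier := H\<rparr>) fst x = F)"
proof -
  interpret regular_tree T arev n
    by fact
  obtain v where v: "v \<in> verts T"
    using connected by (auto simp: connected_def strongly_connected_def)
  obtain lab where "bij_betw lab (out_arcs T v) {1..n}"
    using regular[OF v] finite_same_card_bij[of "out_arcs T v" "{1..n}"]
    by (auto simp: out_degree_def)
  then obtain l F where "uniform_labelling T arev n l H F"
    using exists_uniform_labelling[OF assms(3,4) v] by blast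
  then interpret uniform_labelling T arev n l H F .
  show ?thesis
    by (intro exI conjI ballI) (rule subgroup_F involution_reversal legal_labelling_reversal
      H_subgroup_universal_group local_action_stabilizer, assumption?)+
qed

end
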